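(* Let $L$ and $L'$ be two $\mathfrak{sp}(2n)$-valued Lax operators with the same Tyurin parameters $\{(\alpha_s,\gamma_s)\}$. Then their pointwise commutator $[L,L']=LL'-L'L$ is again an $\mathfrak{sp}(2n)$-valued Lax operator with these Tyurin parameters; that is, the defining conditions of $\mathfrak{sp}(2n)$-valued Lax operators at the points $\gamma_s$ are invariant with respect to the Lie bracket.
   Context: $\Gamma$ is a compact Riemann surface of genus $g$ with two distinct marked points $P_+,P_-$. Fix further distinct points $\gamma_s\in\Gamma\setminus\{P_+,P_-\}$, $s=1,\ldots,ng$, and nonzero vectors $\alpha_s\in\mathbb{C}^{2n}$; the pairs $(\alpha_s,\gamma_s)$ are called Tyurin parameters. Let $\sigma$ be a fixed nondegenerate skew-symmetric complex $2n\times 2n$ matrix; $\mathfrak{sp}(2n)$ is the Lie algebra of complex $2n\times 2n$ matrices $X$ with $X^t=-\sigma X\sigma^{-1}$ (called symplectic matrices here). An $\mathfrak{sp}(2n)$-valued Lax operator is a meromorphic function $L:\Gamma\to\mathfrak{sp}(2n)$, holomorphic outside $P_\pm$ and the $\gamma_s$ (poles of arbitrary finite order are allowed at $P_\pm$), such that at every $\gamma_s$, with $z$ a local coordinate vanishing at $\gamma_s$ and omitting the index $s$, $$L=\frac{L_{-2}}{z^2}+\frac{L_{-1}}{z}+L_0+L_1z+L_2z^2+O(z^3),$$ where all coefficients lie in $\mathfrak{sp}(2n)$ and, for some $\nu\in\mathbb{C}$, $\beta\in\mathbb{C}^{2n}$, $k\in\mathbb{C}$ (depending on $L$ and $s$),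 $$L_{-2}=\nu\alpha\alpha^t\sigma,\quad L_{-1}=(\alpha\beta^t+\beta\alpha^t)\sigma,\quad \beta^t\sigma\alpha=0,\quad L_0\alpha=k\alpha,\quad \alpha^t\sigma L_1\alpha=0.$$ *)

theory Defs
  imports "HOL-Complex_Analysis.Complex_Analysis" "HOL-Homology.Homology"
begin

section \<open>Compact Riemann surfaces\<close>

text \<open>A chart is a pair of a domain and a coordinate map; the coordinate map is a total function
  whose values outside the domain are irrelevant.\<close>

type_synonym 'a chart = "'a set \<times> ('a \<Rightarrow> complex)"

definition complex_chart :: "'a topology \<Rightarrow> 'a chart \<Rightarrow> bool" where
  "complex_chart X c \<longleftrightarrow> (case c of (U, \<phi>) \<Rightarrow>
     openin X U \<and> open (\<phi> ` U) \<and>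
     homeomorphic_map (subtopology X U) (top_of_set (\<phi> ` U)) \<phi>)"

definition compatible_charts :: "'a chart \<Rightarrow> 'a chart \<Rightarrow> bool" where
  "compatible_charts c d \<longleftrightarrow> (case c of (U, \<phi>) \<Rightarrow> case d of (V, \<psi>) \<Rightarrow>
     (\<psi> \<circ> inv_into U \<phi>) holomorphic_on (\<phi> ` (U \<inter> V)) \<and>
     (\<phi> \<circ> inv_into V \<psi>) holomorphic_on (\<psi> ` (U \<inter> V)))"

definition complex_atlas :: "'a topology \<Rightarrow> 'a chart set \<Rightarrow> bool" where
  "complex_atlas X \<A> \<longleftrightarrow>
     (\<forall>c\<in>\<A>. complex_chart X c) \<and> (\<Union>c\<in>\<A>. fst c) = topspace X \<and>
     (\<forall>c\<in>\<A>. \<forall>d\<in>\<A>. compatible_charts c d)"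

definition compact_riemann_surface :: "'a topology \<Rightarrow> 'a chart set \<Rightarrow> bool" where
  "compact_riemann_surface X \<A> \<longleftrightarrow>
     compact_space X \<and> connected_space X \<and> Hausdorff_space X \<and> topspace X \<noteq> {} \<and>
     complex_atlas X \<A>"

text \<open>The genus is half the rank of the first integral homology group.\<close>

definition has_genus :: "'a topology \<Rightarrow> nat \<Rightarrow> bool" where
  "has_genus X g \<longleftrightarrow> homology_group 1 X \<cong> free_Abelian_group {..<2 * g}"

text \<open>A local coordinate vanishing at \<open>p\<close> need not belong to the given atlas, only be compatible
  with it.\<close>

definition local_coordinate_at ::
    "'a topology \<Rightarrow> 'a chart set \<Rightarrow> 'a \<Rightarrow> 'a set \<Rightarrow> ('a \<Rightarrow> complex) \<Rightarrow> bool" where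
  "local_coordinate_at X \<A> p U z \<longleftrightarrow>
     complex_chart X (U, z) \<and> (\<forall>c\<in>\<A>. compatible_charts (U, z) c) \<and> p \<in> U \<and> z p = 0"

section \<open>Matrix-valued functions on a Riemann surface\<close>

text \<open>Meromorphic functions are total functions on the carrier; their values at poles are
  irrelevant.\<close>

definition matrix_meromorphic ::
    "'a chart set \<Rightarrow> ('a \<Rightarrow> complex ^ 'm ^ 'm) \<Rightarrow> bool" where
  "matrix_meromorphic \<A> L \<longleftrightarrow>
     (\<forall>(U, \<phi>)\<in>\<A>. \<forall>i j. (\<lambda>w. L (inv_into U \<phi> w) $ i $ j) meromorphic_on (\<phi> ` U))"

definition matrix_holomorphic_outside ::
    "'a chart set \<Rightarrow> 'a set \<Rightarrow> ('a \<Rightarrow> complex ^ 'm ^ 'm) \<Rightarrow> bool" where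
  "matrix_holomorphic_outside \<A> S L \<longleftrightarrow>
     (\<forall>(U, \<phi>)\<in>\<A>. \<forall>i j. (\<lambda>w. L (inv_into U \<phi> w) $ i $ j) holomorphic_on (\<phi> ` (U - S)))"

text \<open>\<open>F i j\<close> is the Laurent series of the \<open>(i, j)\<close> entry of \<open>L\<close> in the local coordinate \<open>z\<close>.\<close>

definition matrix_laurent_expansion ::
    "'a set \<Rightarrow> ('a \<Rightarrow> complex) \<Rightarrow> ('a \<Rightarrow> complex ^ 'm ^ 'm) \<Rightarrow> ('m \<Rightarrow> 'm \<Rightarrow> complex fls) \<Rightarrow> bool" where
  "matrix_laurent_expansion U z L F \<longleftrightarrow>
     (\<forall>i j. (\<lambda>w. L (inv_into U z w) $ i $ j) has_laurent_expansion F i j)"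

definition laurent_coeff :: "('m::finite \<Rightarrow> 'm \<Rightarrow> complex fls) \<Rightarrow> int \<Rightarrow> complex ^ 'm ^ 'm" where
  "laurent_coeff F k = (\<chi> i j. fls_nth (F i j) k)"

section \<open>Lax operators\<close>

definition symplectic_algebra :: "complex ^ 'm ^ 'm \<Rightarrow> (complex ^ 'm ^ 'm) set" where
  "symplectic_algebra \<sigma> = {X. transpose X = - (\<sigma> ** X ** matrix_inv \<sigma>)}"

text \<open>\<open>outer u v\<close> is \<open>u v\<^sup>t\<close> and \<open>tdot u v\<close> is \<open>u\<^sup>t v\<close>; both are bilinear, without conjugation.\<close>

definition outer :: "complex ^ 'm \<Rightarrow> complex ^ 'm \<Rightarrow> complex ^ 'm ^ 'm" where
  "outer u v = (\<chi> i j. u $ i * v $ j)"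

definition tdot :: "complex ^ 'm \<Rightarrow> complex ^ 'm \<Rightarrow> complex" where
  "tdot u v = (\<Sum>i\<in>UNIV. u $ i * v $ i)"

definition sp_lax_expansion ::
    "complex ^ 'm ^ 'm \<Rightarrow> complex ^ 'm \<Rightarrow> ('m::finite \<Rightarrow> 'm \<Rightarrow> complex fls) \<Rightarrow> bool" where
  "sp_lax_expansion \<sigma> \<alpha> F \<longleftrightarrow>
     (\<forall>k < -2. laurent_coeff F k = 0) \<and>
     (\<forall>k. laurent_coeff F k \<in> symplectic_algebra \<sigma>) \<and>
     (\<exists>\<nu> \<beta> \<kappa>.
        laurent_coeff F (-2) = mat \<nu> ** outer \<alpha> \<alpha> ** \<sigma> \<and>
        laurent_coeff F (-1) = (outer \<alpha> \<beta> + outer \<beta> \<alpha>) ** \<sigma> \<and>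
        tdot \<beta> (\<sigma> *v \<alpha>) = 0 \<and>
        laurent_coeff F 0 *v \<alpha> = \<kappa> *s \<alpha> \<and>
        tdot \<alpha> (\<sigma> *v (laurent_coeff F 1 *v \<alpha>)) = 0)"

text \<open>The expansion is required for every local coordinate vanishing at \<open>\<gamma> s\<close>. The shape of the
  expansion does not depend on that coordinate, but \<open>\<nu>\<close>, \<open>\<beta>\<close> and \<open>\<kappa>\<close> do.\<close>

definition sp_lax_operator ::
    "'a topology \<Rightarrow> 'a chart set \<Rightarrow> complex ^ 'm ^ 'm \<Rightarrow> 'a \<Rightarrow> 'a \<Rightarrow>
     nat set \<Rightarrow> (nat \<Rightarrow> complex ^ 'm) \<Rightarrow> (nat \<Rightarrow> 'a) \<Rightarrow> ('a \<Rightarrow> complex ^ 'm ^ 'm) \<Rightarrow> bool" where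
  "sp_lax_operator X \<A> \<sigma> Pp Pm I \<alpha> \<gamma> L \<longleftrightarrow>
     matrix_meromorphic \<A> L \<and>
     matrix_holomorphic_outside \<A> ({Pp, Pm} \<union> \<gamma> ` I) L \<and>
     (\<forall>p \<in> topspace X - ({Pp, Pm} \<union> \<gamma> ` I). L p \<in> symplectic_algebra \<sigma>) \<and>
     (\<forall>s\<in>I. \<forall>U z. local_coordinate_at X \<A> (\<gamma> s) U z \<longrightarrow>
        (\<exists>F. matrix_laurent_expansion U z L F \<and> sp_lax_expansion \<sigma> (\<alpha> s) F))"

end

(* Write w(u,v) = u^t sigma v, a skew form for which the elements X of sp(2n) satisfy
   w(Xu,v) = -w(u,Xv). Hence [u v^t sigma, X] = -(u (Xv)^t + (Xu) v^t) sigma, so bracketing a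
   principal part with a regular coefficient keeps its rank-one shape, and
   (u v^t sigma)(x y^t sigma) = w(v,x) u y^t sigma, so by the isotropy w(alpha,alpha) = 0 = w(beta,alpha)
   the poles of order 4 and 3 of the commutator cancel. The remaining conditions follow because
   L_{-2} and L_{-1} annihilate alpha and alpha is an eigenvector of L_0. *)

theory Submission
  imports Defs
begin

section \<open>Matrix arithmetic, the bilinear pairing and outer products\<close>

lemma matrix_mult_add_left: "(A + B) ** C = A ** C + B ** (C :: 'a::semiring_1 ^ 'n ^ 'm)"
  by (simp add: matrix_matrix_mult_def vec_eq_iff distrib_right sum.distrib)

lemma matrix_mult_diff_left: "(A - B) ** C = A ** C - B ** (C :: 'a::ring_1 ^ 'n ^ 'm)"
  by (simp add: matrix_matrix_mult_def vec_eq_iff left_diff_distrib sum_subtractf)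

lemma matrix_mult_diff_right: "C ** (A - B) = C ** A - C ** (B :: 'a::ring_1 ^ 'n ^ 'm)"
  by (simp add: matrix_matrix_mult_def vec_eq_iff right_diff_distrib sum_subtractf)

lemma matrix_mult_minus_left: "(- A) ** B = - (A ** (B :: 'a::ring_1 ^ 'n ^ 'm))"
  by (simp add: matrix_matrix_mult_def vec_eq_iff sum_negf)

lemma matrix_mult_minus_right: "A ** (- B) = - (A ** (B :: 'a::ring_1 ^ 'n ^ 'm))"
  by (simp add: matrix_matrix_mult_def vec_eq_iff sum_negf)

lemma matrix_mult_sum_right: "A ** (\<Sum>x\<in>S. f x) = (\<Sum>x\<in>S. A ** (f x :: 'a::ring_1 ^ 'n ^ 'm))"
  by (induction S rule: infinite_finite_induct) (auto simp: matrix_add_ldistrib)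

lemma matrix_mult_sum_left: "(\<Sum>x\<in>S. f x) ** A = (\<Sum>x\<in>S. f x ** (A :: 'a::ring_1 ^ 'n ^ 'm))"
  by (induction S rule: infinite_finite_induct) (auto simp: matrix_mult_add_left)

lemma transpose_diff: "transpose (A - B) = transpose A - transpose (B :: 'a::ring_1 ^ 'n ^ 'm)"
  by (simp add: transpose_def vec_eq_iff)

lemma transpose_sum: "transpose (\<Sum>x\<in>S. f x) = (\<Sum>x\<in>S. transpose (f x :: 'a::ring_1 ^ 'n ^ 'm))"
  by (simp add: transpose_def vec_eq_iff)

lemma minus_matrix_vector: "(- A) *v v = - (A *v (v :: 'a::ring_1 ^ 'n))"
  by (simp add: matrix_vector_mult_def vec_eq_iff sum_negf)

lemma commutator_vector:
  "(X ** Y - Y ** X) *v v = X *v (Y *v v) - Y *v (X *v (v :: 'a::comm_ring_1 ^ 'n))"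
  by (simp add: matrix_vector_mult_diff_rdistrib matrix_vector_mul_assoc)

lemma tdot_simps:
  "tdot (u + v) w = tdot u w + tdot v w" "tdot u (v + w) = tdot u v + tdot u w"
  "tdot (u - v) w = tdot u w - tdot v w" "tdot u (v - w) = tdot u v - tdot u w"
  "tdot (- u) v = - tdot u v" "tdot u (- v) = - tdot u v"
  "tdot (c *s u) v = c * tdot u v" "tdot u (c *s v) = c * tdot u v"
  "tdot 0 u = 0" "tdot u 0 = 0"
  by (simp_all add: tdot_def algebra_simps sum.distrib sum_subtractf sum_negf sum_distrib_left)

lemma tdot_commute: "tdot u v = tdot v u"
  by (simp add: tdot_def mult.commute)

lemma tdot_transpose: "tdot u (A *v v) = tdot (transpose A *v u) v"
proof -
  have "tdot u (A *v v) = (\<Sum>i\<in>UNIV. \<Sum>j\<in>UNIV. u $ i * (A $ i $ j * v $ j))"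
    by (simp add: tdot_def matrix_vector_mult_def sum_distrib_left)
  also have "\<dots> = (\<Sum>j\<in>UNIV. \<Sum>i\<in>UNIV. u $ i * (A $ i $ j * v $ j))"
    by (rule sum.swap)
  also have "\<dots> = tdot (transpose A *v u) v"
    by (simp add: tdot_def matrix_vector_mult_def vector_matrix_mult_def sum_distrib_left
        transpose_def mult_ac del: transpose_matrix_vector)
  finally show ?thesis .
qed

lemma outer_simps:
  "outer (u + v) w = outer u w + outer v w" "outer u (v + w) = outer u v + outer u w"
  "outer (u - v) w = outer u w - outer v w" "outer u (v - w) = outer u v - outer u w"
  "outer (- u) v = - outer u v" "outer u (- v) = - outer u v"
  "outer 0 u = 0" "outer u 0 = 0"
  by (simp_all add: outer_def vec_eq_iff algebra_simps)

lemma outer_scale: "mat c ** outer u v = outer (c *s u) v"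
  by (simp add: outer_def vec_eq_iff mult.assoc mat_def matrix_matrix_mult_def
      if_distrib if_distribR cong: if_cong)

lemma outer_mult_vector: "outer u v *v w = tdot v w *s u"
  by (simp add: outer_def tdot_def vec_eq_iff matrix_vector_mult_def sum_distrib_left mult_ac)

lemma mult_outer: "A ** outer u v = outer (A *v u) v"
  by (simp add: outer_def vec_eq_iff matrix_vector_mult_def matrix_matrix_mult_def
      sum_distrib_left mult_ac)

lemma outer_mult: "outer u v ** A = outer u (transpose A *v v)"
  by (simp add: outer_def vec_eq_iff matrix_vector_mult_def matrix_matrix_mult_def
      sum_distrib_left transpose_def mult_ac del: transpose_matrix_vector)

section \<open>The symplectic algebra and its action on rank-one matrices\<close>

lemma symplectic_algebra_iff:
  assumes "invertible \<sigma>"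
  shows "X \<in> symplectic_algebra \<sigma> \<longleftrightarrow> transpose X ** \<sigma> = - (\<sigma> ** X)"
proof -
  \<comment> \<open>\<open>matrix_inv\<close> is defined by choice; invertibility is what makes the
    chosen matrix a two-sided inverse.\<close>
  have inv: "matrix_inv \<sigma> ** \<sigma> = mat 1" "\<sigma> ** matrix_inv \<sigma> = mat 1"
    using assms unfolding invertible_def matrix_inv_def by (metis (mono_tags, lifting) someI_ex)+
  show ?thesis
  proof
    assume "X \<in> symplectic_algebra \<sigma>"
    then have "transpose X ** \<sigma> = - (\<sigma> ** X ** (matrix_inv \<sigma> ** \<sigma>))"
      by (simp add: symplectic_algebra_def matrix_mult_minus_left matrix_mul_assoc)
    then show "transpose X ** \<sigma> = - (\<sigma> ** X)"
      by (simp add: inv)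
  next
    assume *: "transpose X ** \<sigma> = - (\<sigma> ** X)"
    have "transpose X = transpose X ** \<sigma> ** matrix_inv \<sigma>"
      by (simp add: inv flip: matrix_mul_assoc)
    also have "\<dots> = - (\<sigma> ** X ** matrix_inv \<sigma>)"
      by (simp add: * matrix_mult_minus_left)
    finally show "X \<in> symplectic_algebra \<sigma>"
      by (simp add: symplectic_algebra_def)
  qed
qed

text \<open>Moving \<sigma> past two transposes costs two signs, which cancel, while transposition
  reverses the factors. So \<open>X ** Y\<close> is turned into \<open>Y ** X\<close> and only the
  difference picks up the required sign.\<close>

lemma symplectic_algebra_commutator:
  assumes "invertible \<sigma>" "X \<in> symplectic_algebra \<sigma>" "Y \<in> symplectic_algebra \<sigma>"
  shows "X ** Y - Y ** X \<in> symplectic_algebra \<sigma>"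
proof -
  have *: "transpose A ** transpose B ** \<sigma> = \<sigma> ** A ** B"
    if "A \<in> symplectic_algebra \<sigma>" "B \<in> symplectic_algebra \<sigma>" for A B
  proof -
    have "transpose A ** (transpose B ** \<sigma>) = - (transpose A ** \<sigma> ** B)"
      using that assms(1) by (simp add: symplectic_algebra_iff matrix_mult_minus_right matrix_mul_assoc)
    then show ?thesis
      using that assms(1) by (simp add: symplectic_algebra_iff matrix_mult_minus_left matrix_mul_assoc)
  qed
  show ?thesis
    using assms by (simp add: symplectic_algebra_iff transpose_diff matrix_transpose_mul
        matrix_mult_diff_left matrix_mult_diff_right * matrix_mul_assoc)
qed

lemma symplectic_algebra_sum:
  assumes "invertible \<sigma>" "\<And>x. x \<in> S \<Longrightarrow> f x \<in> symplectic_algebra \<sigma>"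
  shows "(\<Sum>x\<in>S. f x) \<in> symplectic_algebra \<sigma>"
  using assms by (simp add: symplectic_algebra_iff transpose_sum matrix_mult_sum_left
      matrix_mult_sum_right flip: sum_negf)

lemma skew_form:
  assumes "transpose \<sigma> = - \<sigma>"
  shows "tdot u (\<sigma> *v v) = - tdot v (\<sigma> *v u)"
  unfolding tdot_transpose[of u] assms by (simp add: minus_matrix_vector tdot_simps tdot_commute)

lemma symplectic_algebra_adjoint:
  assumes "invertible \<sigma>" "X \<in> symplectic_algebra \<sigma>"
  shows "tdot u (\<sigma> *v (X *v v)) = - tdot (X *v u) (\<sigma> *v v)"
proof -
  have "tdot (X *v u) (\<sigma> *v v) = tdot u ((transpose X ** \<sigma>) *v v)"
    by (simp add: tdot_transpose[of u "transpose X"] flip: matrix_vector_mul_assoc del: transpose_matrix_vector)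
  also have "\<dots> = - tdot u (\<sigma> *v (X *v v))"
    using assms by (simp add: symplectic_algebra_iff minus_matrix_vector tdot_simps matrix_vector_mul_assoc)
  finally show ?thesis by simp
qed

text \<open>\<open>X\<close> passes \<sigma> as minus its transpose, and that transpose acts on the
  second vector as \<open>X\<close> itself. Together with \<open>mult_outer\<close> this evaluates
  the bracket of a polar coefficient with any element of the algebra.\<close>

lemma outer_symplectic_mult:
  assumes "invertible \<sigma>" "X \<in> symplectic_algebra \<sigma>"
  shows "outer u v ** \<sigma> ** X = - (outer u (X *v v) ** \<sigma>)"
proof -
  have "outer u v ** \<sigma> ** X = outer u v ** (- (transpose X ** \<sigma>))"
    using assms by (simp add: symplectic_algebra_iff flip: matrix_mul_assoc)
  also have "\<dots> = - (outer u (X *v v) ** \<sigma>)"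
    by (simp add: matrix_mult_minus_right matrix_mul_assoc outer_mult[of u v "transpose X"])
  finally show ?thesis .
qed

lemma outer_mult_vector_form: "(outer u v ** \<sigma>) *v w = tdot v (\<sigma> *v w) *s u"
  by (simp add: outer_mult_vector flip: matrix_vector_mul_assoc)

lemma outer_form_mult_outer_form:
  "outer u v ** \<sigma> ** (outer w x ** \<sigma>) = outer (tdot v (\<sigma> *v w) *s u) x ** \<sigma>"
proof -
  have "outer u v ** \<sigma> ** (outer w x ** \<sigma>) = (outer u v ** \<sigma>) ** outer w x ** \<sigma>"
    by (simp add: matrix_mul_assoc)
  then show ?thesis
    by (simp only: mult_outer outer_mult_vector_form)
qed

section \<open>Laurent coefficients of products and commutators\<close>

lemma fls_times_nth_bounded:
  fixes f g :: "'b::{comm_monoid_add, mult_zero} fls"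
  assumes "\<And>i. i < d \<Longrightarrow> fls_nth f i = 0" "\<And>i. i < e \<Longrightarrow> fls_nth g i = 0"
  shows "fls_nth (f * g) k = (\<Sum>i=d..k - e. fls_nth f i * fls_nth g (k - i))"
\<comment> \<open>A zero factor is split off because the zero series has subdegree 0 by convention,
  which may lie below the given bounds. Otherwise the wider range only adds zero terms.\<close>
proof (cases "f = 0 \<or> g = 0")
  case False
  then have "d \<le> fls_subdegree f" "e \<le> fls_subdegree g"
    using assms by (simp_all add: fls_subdegree_geI)
  then show ?thesis
    unfolding fls_times_nth(2) by (intro sum.mono_neutral_left) auto
qed auto

text \<open>Expansions are families of scalar series rather than matrices, so the commutator is
  spelled out entrywise.\<close>

definition fls_commutator ::
    "('m::finite \<Rightarrow> 'm \<Rightarrow> complex fls) \<Rightarrow> ('m \<Rightarrow> 'm \<Rightarrow> complex fls) \<Rightarrow> 'm \<Rightarrow> 'm \<Rightarrow> complex fls" where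
  "fls_commutator F G i j = (\<Sum>k\<in>UNIV. F i k * G k j) - (\<Sum>k\<in>UNIV. G i k * F k j)"

text \<open>A bound on the matrix coefficients bounds all entries at once, whatever their own
  subdegrees. All entrywise Cauchy products then run over one range, and the two finite sums can be
  exchanged.\<close>

lemma laurent_coeff_mult:
  assumes "\<And>k. k < d \<Longrightarrow> laurent_coeff F k = 0" "\<And>k. k < e \<Longrightarrow> laurent_coeff G k = 0"
  shows "laurent_coeff (\<lambda>i j. \<Sum>l\<in>UNIV. F i l * G l j) k =
    (\<Sum>i=d..k - e. laurent_coeff F i ** laurent_coeff G (k - i))"
proof -
  have "fls_nth (F i l) k = 0" if "k < d" for k i l
    using assms(1)[OF that] by (simp add: laurent_coeff_def vec_eq_iff)
  moreover have "fls_nth (G i l) k = 0" if "k < e" for k i l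
    using assms(2)[OF that] by (simp add: laurent_coeff_def vec_eq_iff)
  ultimately have "fls_nth (F i l * G l j) k =
      (\<Sum>p=d..k - e. fls_nth (F i l) p * fls_nth (G l j) (k - p))" for i j l
    by (intro fls_times_nth_bounded) auto
  then have "fls_nth (\<Sum>l\<in>UNIV. F i l * G l j) k =
      (\<Sum>p=d..k - e. \<Sum>l\<in>UNIV. fls_nth (F i l) p * fls_nth (G l j) (k - p))" for i j
    by (simp only: fls_nth_sum) (rule sum.swap)
  then show ?thesis
    by (simp add: laurent_coeff_def vec_eq_iff matrix_matrix_mult_def)
qed

lemma laurent_coeff_commutator:
  assumes "\<And>k. k < d \<Longrightarrow> laurent_coeff F k = 0" "\<And>k. k < d \<Longrightarrow> laurent_coeff G k = 0"
  shows "laurent_coeff (fls_commutator F G) k =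
    (\<Sum>i=d..k - d. laurent_coeff F i ** laurent_coeff G (k - i) -
      laurent_coeff G (k - i) ** laurent_coeff F i)"
proof -
  have "laurent_coeff (fls_commutator F G) k =
      laurent_coeff (\<lambda>i j. \<Sum>l\<in>UNIV. F i l * G l j) k - laurent_coeff (\<lambda>i j. \<Sum>l\<in>UNIV. G i l * F l j) k"
    by (simp add: laurent_coeff_def fls_commutator_def vec_eq_iff)
  \<comment> \<open>The substitution of \<open>k - i\<close> for \<open>i\<close> preserves the
    range because both series have the same bound \<open>d\<close>. It makes each summand a
    commutator.\<close>
  moreover have "(\<Sum>i=d..k - d. laurent_coeff G i ** laurent_coeff F (k - i)) =
      (\<Sum>i=d..k - d. laurent_coeff G (k - i) ** laurent_coeff F i)"
    by (rule sum.reindex_bij_witness[of _ "\<lambda>i. k - i" "\<lambda>i. k - i"]) auto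
  ultimately show ?thesis
    by (simp add: laurent_coeff_mult[OF assms] laurent_coeff_mult[OF assms(2,1)] sum_subtractf)
qed

section \<open>Analytic conditions on the pointwise commutator\<close>

lemma matrix_laurent_expansion_commutator:
  assumes "matrix_laurent_expansion U z L F" "matrix_laurent_expansion U z L' G"
  shows "matrix_laurent_expansion U z (\<lambda>p. L p ** L' p - L' p ** L p) (fls_commutator F G)"
  using assms unfolding matrix_laurent_expansion_def fls_commutator_def
  by (auto simp: matrix_matrix_mult_def intro!: laurent_expansion_intros)

lemma matrix_meromorphic_commutator:
  assumes "matrix_meromorphic \<A> L" "matrix_meromorphic \<A> L'"
  shows "matrix_meromorphic \<A> (\<lambda>p. L p ** L' p - L' p ** L p)"
  using assms unfolding matrix_meromorphic_def
  by (fastforce simp: matrix_matrix_mult_def intro!: meromorphic_intros)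

lemma matrix_holomorphic_outside_commutator:
  assumes "matrix_holomorphic_outside \<A> S L" "matrix_holomorphic_outside \<A> S L'"
  shows "matrix_holomorphic_outside \<A> S (\<lambda>p. L p ** L' p - L' p ** L p)"
  using assms unfolding matrix_holomorphic_outside_def
  by (fastforce simp: matrix_matrix_mult_def intro!: holomorphic_intros)

section \<open>The local conditions at a point of the Tyurin data\<close>

lemma sp_lax_expansion_commutator:
  assumes inv: "invertible \<sigma>" and skew: "transpose \<sigma> = - \<sigma>"
    and F: "sp_lax_expansion \<sigma> \<alpha> F" and G: "sp_lax_expansion \<sigma> \<alpha> G"
  shows "sp_lax_expansion \<sigma> \<alpha> (fls_commutator F G)"
proof -
  define A B C where "A = laurent_coeff F" and "B = laurent_coeff G"
    and "C = laurent_coeff (fls_commutator F G)"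
  let ?\<omega> = "\<lambda>u v. tdot u (\<sigma> *v v)"
  obtain \<nu> \<beta> \<kappa> where A: "\<And>k. k < -2 \<Longrightarrow> A k = 0" "\<And>k. A k \<in> symplectic_algebra \<sigma>"
    "A (-2) = mat \<nu> ** outer \<alpha> \<alpha> ** \<sigma>" "A (-1) = (outer \<alpha> \<beta> + outer \<beta> \<alpha>) ** \<sigma>"
    "?\<omega> \<beta> \<alpha> = 0" "A 0 *v \<alpha> = \<kappa> *s \<alpha>" "?\<omega> \<alpha> (A 1 *v \<alpha>) = 0"
    using F unfolding sp_lax_expansion_def A_def by auto
  obtain \<nu>' \<beta>' \<kappa>' where B: "\<And>k. k < -2 \<Longrightarrow> B k = 0" "\<And>k. B k \<in> symplectic_algebra \<sigma>"
    "B (-2) = mat \<nu>' ** outer \<alpha> \<alpha> ** \<sigma>" "B (-1) = (outer \<alpha> \<beta>' + outer \<beta>' \<alpha>) ** \<sigma>"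
    "?\<omega> \<beta>' \<alpha> = 0" "B 0 *v \<alpha> = \<kappa>' *s \<alpha>" "?\<omega> \<alpha> (B 1 *v \<alpha>) = 0"
    using G unfolding sp_lax_expansion_def B_def by auto
  \<comment> \<open>The scalar is absorbed into the first vector, so that every polar coefficient is
    a sum of terms \<open>outer u v ** \<sigma>\<close>.\<close>
  have Am2: "A (-2) = outer (\<nu> *s \<alpha>) \<alpha> ** \<sigma>" and Bm2: "B (-2) = outer (\<nu>' *s \<alpha>) \<alpha> ** \<sigma>"
    by (simp_all add: A B outer_scale)
  have Am1: "A (-1) = outer \<alpha> \<beta> ** \<sigma> + outer \<beta> \<alpha> ** \<sigma>"
    and Bm1: "B (-1) = outer \<alpha> \<beta>' ** \<sigma> + outer \<beta>' \<alpha> ** \<sigma>"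
    by (simp_all add: A B matrix_mult_add_left)
  have \<alpha>\<alpha>: "?\<omega> \<alpha> \<alpha> = 0"
    using skew_form[OF skew, of \<alpha> \<alpha>] by simp
  have \<alpha>\<beta>: "?\<omega> \<alpha> \<beta> = 0" "?\<omega> \<alpha> \<beta>' = 0"
    using skew_form[OF skew, of \<alpha> \<beta>] skew_form[OF skew, of \<alpha> \<beta>'] A B by simp_all
  note isotropic = \<alpha>\<alpha> \<alpha>\<beta> A(5) B(5)
  have C: "C k = (\<Sum>i=-2..k + 2. A i ** B (k - i) - B (k - i) ** A i)" for k
    using laurent_coeff_commutator[of "-2" F G k] A(1) B(1) by (simp add: A_def B_def C_def)
  have sp: "C k \<in> symplectic_algebra \<sigma>" for k
    unfolding C by (intro symplectic_algebra_sum symplectic_algebra_commutator inv A B)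
  \<comment> \<open>The ranges \<open>-2..k + 2\<close> for \<open>k\<close> from -3 to 1, written
    out; for \<open>k = -4\<close> the sum has the single index -2.\<close>
  have "{-2..-1::int} = {-2, -1}" "{-2..0::int} = {-2, -1, 0}" "{-2..1::int} = {-2, -1, 0, 1}"
    "{-2..2::int} = {-2, -1, 0, 1, 2}" "{-2..3::int} = {-2, -1, 0, 1, 2, 3}"
    by auto
  note C_expand = C this
  have Cm4: "C (-4) = 0"
    by (simp add: C Am2 Bm2 outer_form_mult_outer_form isotropic outer_simps tdot_simps vector_scalar_commute)
  have Cm3: "C (-3) = 0"
    by (simp add: C_expand Am2 Bm2 Am1 Bm1 matrix_add_ldistrib matrix_mult_add_left
        outer_form_mult_outer_form isotropic outer_simps tdot_simps vector_scalar_commute)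
  \<comment> \<open>For \<open>k < -4\<close> the range of summation is empty.\<close>
  have low: "C k = 0" if "k < -2" for k
    using that Cm3 Cm4 C[of k] by (cases "k = -3"; cases "k = -4") auto
  \<comment> \<open>The order of the factors follows the summands of \<open>C\<close>: coefficients
    of \<open>F\<close> come first, those of \<open>G\<close> second. \<open>X\<close> will be
    \<open>B 0\<close> or \<open>B 1\<close> against the poles of \<open>F\<close>, and
    \<open>A 0\<close> or \<open>A 1\<close> against those of \<open>G\<close>.\<close>
  have Am2_commutator: "A (-2) ** X - X ** A (-2) = (- outer (\<nu> *s \<alpha>) (X *v \<alpha>) - outer (\<nu> *s (X *v \<alpha>)) \<alpha>) ** \<sigma>"
    and Bm2_commutator: "X ** B (-2) - B (-2) ** X = (outer (\<nu>' *s \<alpha>) (X *v \<alpha>) + outer (\<nu>' *s (X *v \<alpha>)) \<alpha>) ** \<sigma>"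
    and Am1_commutator: "A (-1) ** X - X ** A (-1) =
      (- outer \<alpha> (X *v \<beta>) - outer (X *v \<alpha>) \<beta> - outer \<beta> (X *v \<alpha>) - outer (X *v \<beta>) \<alpha>) ** \<sigma>"
    and Bm1_commutator: "X ** B (-1) - B (-1) ** X =
      (outer \<alpha> (X *v \<beta>') + outer (X *v \<alpha>) \<beta>' + outer \<beta>' (X *v \<alpha>) + outer (X *v \<beta>') \<alpha>) ** \<sigma>"
    if "X \<in> symplectic_algebra \<sigma>" for X
    using that by (simp_all add: Am2 Bm2 Am1 Bm1 vector_scalar_commute matrix_add_ldistrib
        matrix_mult_add_left matrix_mult_diff_left matrix_mult_minus_left outer_symplectic_mult[OF inv]
        matrix_mul_assoc[of X] mult_outer)
  \<comment> \<open>Isotropy leaves in each product only the term that pairs \<beta> with \<beta>'.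
    By skewness the two contributions add up, hence the factor 2.\<close>
  have "A (-1) ** B (-1) - B (-1) ** A (-1) =
      (outer (?\<omega> \<beta> \<beta>' *s \<alpha>) \<alpha> - outer (?\<omega> \<beta>' \<beta> *s \<alpha>) \<alpha>) ** \<sigma>"
    by (simp add: Am1 Bm1 matrix_add_ldistrib matrix_mult_add_left outer_form_mult_outer_form
        isotropic outer_simps matrix_mult_diff_left)
  also have "outer (?\<omega> \<beta> \<beta>' *s \<alpha>) \<alpha> - outer (?\<omega> \<beta>' \<beta> *s \<alpha>) \<alpha> = outer ((2 * ?\<omega> \<beta> \<beta>') *s \<alpha>) \<alpha>"
    unfolding skew_form[OF skew, of \<beta>' \<beta>] by (simp add: outer_def vec_eq_iff algebra_simps)
  finally have Am1_Bm1: "A (-1) ** B (-1) - B (-1) ** A (-1) = outer ((2 * ?\<omega> \<beta> \<beta>') *s \<alpha>) \<alpha> ** \<sigma>" .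
  \<comment> \<open>Each bracket in \<open>C (-2)\<close> is a multiple of
    \<open>outer \<alpha> \<alpha> ** \<sigma>\<close>, since \<alpha> is an eigenvector of
    \<open>A 0\<close> and \<open>B 0\<close>; the three multiples are added.\<close>
  define \<nu>'' where "\<nu>'' = 2 * (\<kappa> * \<nu>' - \<kappa>' * \<nu> + ?\<omega> \<beta> \<beta>')"
  \<comment> \<open>The vectors that stand next to \<alpha> in the outer products of
    \<open>C (-1)\<close>, once \<open>A 0\<close> and \<open>B 0\<close> are replaced by their
    eigenvalues on \<alpha>.\<close>
  define \<beta>'' where "\<beta>'' = \<nu>' *s (A 1 *v \<alpha>) - \<nu> *s (B 1 *v \<alpha>) + A 0 *v \<beta>' + \<kappa> *s \<beta>'
    - B 0 *v \<beta> - \<kappa>' *s \<beta>"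
  have "C (-2) = (- outer (\<nu> *s \<alpha>) (B 0 *v \<alpha>) - outer (\<nu> *s (B 0 *v \<alpha>)) \<alpha> +
      outer ((2 * ?\<omega> \<beta> \<beta>') *s \<alpha>) \<alpha> +
      (outer (\<nu>' *s \<alpha>) (A 0 *v \<alpha>) + outer (\<nu>' *s (A 0 *v \<alpha>)) \<alpha>)) ** \<sigma>"
    by (simp add: C_expand Am2_commutator Bm2_commutator Am1_Bm1 A(2) B(2) matrix_mult_add_left)
  also have "\<dots> = mat \<nu>'' ** outer \<alpha> \<alpha> ** \<sigma>"
    by (intro arg_cong2[of _ _ _ _ "(**)"] refl, unfold A(6) B(6) outer_scale)
      (simp add: outer_def vec_eq_iff \<nu>''_def algebra_simps)
  finally have Cm2: "C (-2) = mat \<nu>'' ** outer \<alpha> \<alpha> ** \<sigma>" .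
  have "C (-1) = (- outer (\<nu> *s \<alpha>) (B 1 *v \<alpha>) - outer (\<nu> *s (B 1 *v \<alpha>)) \<alpha> +
      (- outer \<alpha> (B 0 *v \<beta>) - outer (B 0 *v \<alpha>) \<beta> - outer \<beta> (B 0 *v \<alpha>) - outer (B 0 *v \<beta>) \<alpha>) +
      (outer \<alpha> (A 0 *v \<beta>') + outer (A 0 *v \<alpha>) \<beta>' + outer \<beta>' (A 0 *v \<alpha>) + outer (A 0 *v \<beta>') \<alpha>) +
      (outer (\<nu>' *s \<alpha>) (A 1 *v \<alpha>) + outer (\<nu>' *s (A 1 *v \<alpha>)) \<alpha>)) ** \<sigma>"
    by (simp add: C_expand Am2_commutator Bm2_commutator Am1_commutator Bm1_commutator A(2) B(2) matrix_mult_add_left)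
  also have "\<dots> = (outer \<alpha> \<beta>'' + outer \<beta>'' \<alpha>) ** \<sigma>"
    unfolding A(6) B(6) by (intro arg_cong2[of _ _ _ _ "(**)"] refl)
      (simp add: outer_def vec_eq_iff \<beta>''_def algebra_simps)
  finally have Cm1: "C (-1) = (outer \<alpha> \<beta>'' + outer \<beta>'' \<alpha>) ** \<sigma>" .
  have adj: "?\<omega> (A k *v u) v = - ?\<omega> u (A k *v v)" "?\<omega> (B k *v u) v = - ?\<omega> u (B k *v v)" for k u v
    using symplectic_algebra_adjoint[OF inv A(2), of u k v]
      symplectic_algebra_adjoint[OF inv B(2), of u k v] by simp_all
  \<comment> \<open>The terms with \<open>A 1\<close> and \<open>B 1\<close> vanish by the condition
    on the linear coefficient. In those with \<open>A 0\<close> and \<open>B 0\<close> the matrix is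
    moved onto its eigenvector \<alpha>, and isotropy of \<beta> and \<beta>' does the rest.\<close>
  have \<beta>_isotropic: "?\<omega> \<beta>'' \<alpha> = 0"
    by (simp add: \<beta>''_def tdot_simps adj A(6,7) B(6,7) isotropic vector_scalar_commute)
  have annihilate: "A (-2) *v \<alpha> = 0" "A (-1) *v \<alpha> = 0" "B (-2) *v \<alpha> = 0" "B (-1) *v \<alpha> = 0"
    by (simp_all add: Am2 Bm2 Am1 Bm1 outer_mult_vector_form isotropic matrix_vector_mult_add_rdistrib)
  \<comment> \<open>In \<open>C 0 *v \<alpha>\<close> only products whose polar factor acts last
    survive: acting first it kills \<alpha>, and \<open>A 0\<close>, \<open>B 0\<close> commute on
    their common eigenvector. The components along \<beta> and \<beta>' drop out by the condition on
    \<open>A 1\<close> and \<open>B 1\<close>.\<close>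
  define \<kappa>'' where "\<kappa>'' = \<nu> * ?\<omega> \<alpha> (B 2 *v \<alpha>) + ?\<omega> \<beta> (B 1 *v \<alpha>)
    - \<nu>' * ?\<omega> \<alpha> (A 2 *v \<alpha>) - ?\<omega> \<beta>' (A 1 *v \<alpha>)"
  have "A (-2) *v v = (\<nu> * ?\<omega> \<alpha> v) *s \<alpha>" "B (-2) *v v = (\<nu>' * ?\<omega> \<alpha> v) *s \<alpha>"
    "A (-1) *v v = ?\<omega> \<beta> v *s \<alpha> + ?\<omega> \<alpha> v *s \<beta>" "B (-1) *v v = ?\<omega> \<beta>' v *s \<alpha> + ?\<omega> \<alpha> v *s \<beta>'" for v
    by (simp_all add: Am2 Bm2 Am1 Bm1 outer_mult_vector_form matrix_vector_mult_add_rdistrib mult_ac)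
  note act = this
  have C0: "C 0 *v \<alpha> = \<kappa>'' *s \<alpha>"
    by (simp add: C_expand commutator_vector matrix_vector_mult_add_rdistrib annihilate)
      (simp add: act A(6,7) B(6,7) vector_scalar_commute \<kappa>''_def algebra_simps)
  \<comment> \<open>Since the indices add up to 1, either one factor is polar or they are 0 and 1. A
    polar factor kills \<alpha>, directly or after being moved across the form; otherwise the
    eigenvalue comes out and the condition on \<open>A 1\<close> or \<open>B 1\<close>
    applies.\<close>
  have "?\<omega> \<alpha> (A i *v (B j *v \<alpha>)) = 0" "?\<omega> \<alpha> (B j *v (A i *v \<alpha>)) = 0"
    if ij: "i + j = 1" "-2 \<le> i" "-2 \<le> j" for i j
  proof -
    consider "i = -2" | "i = -1" | "i = 0" "j = 1" | "i = 1" "j = 0" | "j = -1" | "j = -2"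
      using ij by linarith
    then show "?\<omega> \<alpha> (A i *v (B j *v \<alpha>)) = 0" "?\<omega> \<alpha> (B j *v (A i *v \<alpha>)) = 0"
      using adj(1)[of i \<alpha> "B j *v \<alpha>"] adj(2)[of j \<alpha> "A i *v \<alpha>"]
      by (cases; simp add: annihilate A(6,7) B(6,7) vector_scalar_commute tdot_simps)+
  qed
  then have "?\<omega> \<alpha> (C 1 *v \<alpha>) = 0"
    by (simp add: C_expand commutator_vector matrix_vector_mult_add_rdistrib matrix_vector_right_distrib
         matrix_vector_mult_diff_distrib tdot_simps)
  then show ?thesis
    using sp low Cm2 Cm1 \<beta>_isotropic C0 unfolding sp_lax_expansion_def C_def by blast
qed

theorem lemma2p3:
  fixes X :: "'a topology"
    and \<A> :: "'a chart set"
    and g n :: nat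
    and \<sigma> :: "complex ^ 'm ^ 'm"
    and Pp Pm :: 'a
    and \<gamma> :: "nat \<Rightarrow> 'a"
    and \<alpha> :: "nat \<Rightarrow> complex ^ 'm"
    and L L' :: "'a \<Rightarrow> complex ^ 'm ^ 'm"
  assumes "compact_riemann_surface X \<A>"
    and "has_genus X g"
    and "CARD('m) = 2 * n"
    and "invertible \<sigma>"
    and "transpose \<sigma> = - \<sigma>"
    and "Pp \<in> topspace X" and "Pm \<in> topspace X" and "Pp \<noteq> Pm"
    and "\<gamma> ` {1..n * g} \<subseteq> topspace X - {Pp, Pm}"
    and "inj_on \<gamma> {1..n * g}"
    and "\<forall>s\<in>{1..n * g}. \<alpha> s \<noteq> 0"
    and "sp_lax_operator X \<A> \<sigma> Pp Pm {1..n * g} \<alpha> \<gamma> L"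
    and "sp_lax_operator X \<A> \<sigma> Pp Pm {1..n * g} \<alpha> \<gamma> L'"
  shows "sp_lax_operator X \<A> \<sigma> Pp Pm {1..n * g} \<alpha> \<gamma> (\<lambda>p. L p ** L' p - L' p ** L p)"
proof -
  \<comment> \<open>Both operators are expanded in the same local coordinate, so the two series can
    be multiplied. Away from the marked points and the \<open>\<gamma> s\<close>, membership in the
    algebra is a pointwise matter.\<close>
  have "\<exists>H. matrix_laurent_expansion U z (\<lambda>p. L p ** L' p - L' p ** L p) H \<and>
      sp_lax_expansion \<sigma> (\<alpha> s) H"
    if "s \<in> {1..n * g}" "local_coordinate_at X \<A> (\<gamma> s) U z" for s U z
  proof -
    obtain F G where "matrix_laurent_expansion U z L F" "sp_lax_expansion \<sigma> (\<alpha> s) F"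
      "matrix_laurent_expansion U z L' G" "sp_lax_expansion \<sigma> (\<alpha> s) G"
      using assms(12,13) \<open>s \<in> {1..n * g}\<close> \<open>local_coordinate_at X \<A> (\<gamma> s) U z\<close>
      unfolding sp_lax_operator_def by meson
    then show ?thesis
      using sp_lax_expansion_commutator[OF \<open>invertible \<sigma>\<close> \<open>transpose \<sigma> = - \<sigma>\<close>]
        matrix_laurent_expansion_commutator by blast
  qed
  then show ?thesis
    using assms(12,13) unfolding sp_lax_operator_def
    by (auto simp: matrix_meromorphic_commutator matrix_holomorphic_outside_commutator
        symplectic_algebra_commutator[OF \<open>invertible \<sigma>\<close>])
qed

end
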